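(* Let $\Delta\subset M_{\mathbb{R}}$ be the polytope associated to a toric Fano threefold $X$ satisfying Candelas' conditions 1) and 2). Assume also that $\Delta$ is simple and that $\Delta^\varphi\subset\Delta$, the dual of $\nabla^\varphi$, determines a simple, mildly singular semistable partition $\{\Delta_1,\Delta_2\}$ of $\Delta$. Let $f:\tilde{\mathbb{P}}_\Delta\to\mathbb{C}$ be the induced weak semistable degeneration. Then the rays of the toric fan of $\mathbb{P}_{\Delta_1}$ are the rays of $\mathbb{P}_\Delta$ with $z_3\ge0$ together with the ray $z_1=z_2=0,\ z_3\ge0$; similarly, the rays of the toric fan of $\mathbb{P}_{\Delta_2}$ are the rays of $\mathbb{P}_\Delta$ with $z_3\le0$ together with the ray $z_1=z_2=0,\ z_3\le0$.
   Context: $N\simeq\mathbb{Z}^3$ and $M$ are dual lattices with real extensions $N_{\mathbb{R}},M_{\mathbb{R}}$; $\Delta\subset M_{\mathbb{R}}$ is a reflexive $3$-dimensional polytope with dual $\nabla=\{v\in N_{\mathbb{R}}:\langle m,v\rangle\ge-1\ \text{for all}\ m\in\Delta\}$. For a lattice polytope $P\subset M_{\mathbb{R}}$, $\mathbb{P}_P$ is the projective toric variety of the normal fan of $P$; here $X=\mathbb{P}_\Delta$. $\Delta$ simple means that $\mathbb{P}_\Delta$ is simplicial. $\nabla$ contains a $2$-dimensional reflexive polytope $\nabla^\varphi\subset N_{\varphi,\mathbb{R}}$, where $N_\varphi\subset N$ is a rank-2 sublattice. Candelas' conditions 1) and 2), up to a lattice automorphism in $\mathrm{SL}(3,\mathbb{Z})$: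 1) $N_\varphi$ is a summand of $N$, with induced morphism of lattices $N\twoheadrightarrow N_\varphi$, $(z_1,z_2,z_3)\mapsto(z_1,z_2)$; 2) under this morphism the lattice points of $\nabla$ are sent onto points of $\nabla^\varphi$. Condition 1) induces a splitting of $M$ with coordinates $(z_1^*,z_2^*,z_3^* )$, and $\Delta\cap\{z_3^*=0\}$ is $\Delta^\varphi$, the dual of $\nabla^\varphi$. $\Delta^\varphi$ divides $\Delta$ into two polytopes $\Delta_1$ and $\Delta_2$. The following notions are those of S. Hu. The partition $\{\Delta_1,\Delta_2\}$ is simple if each $\Delta_j$ is simple. It is semistable if any $\ell$-face of $\Delta_j$, $\ell=1,2$, is contained in exactly $k-\ell+1$ of the polytopes $\Delta_1,\Delta_2$ if there is a $k$-face of $\Delta$ containing it. It is also balanced, since all vertices of the $\Delta_j$ which are not vertices of $\Delta$ lie on an edge of $\Delta$. A semistable, balanced partition is mildly singular if the vertices of $\Delta_j$ which are not vertices of $\Delta$ are nonsingular in each $\Delta_j$, i.e. the primitive vectors at such a vertex span the lattice $M$ over $\mathbb{Z}$. By a theorem of Hu, a mildly singular semistable partition $\{\Delta_1,\Delta_2\}$ of $\Delta$ gives a weak semistable degeneration (in Hu's sense) of $\mathbb{P}_\Delta$, $f:\tilde{\mathbb{P}}_\Delta\to\mathbb{C}$, with central fiber $\mathbb{P}_{\Delta_1}\cup\mathbb{P}_{\Delta_2}$ and $\mathbb{P}_{\Delta_1}\cap\mathbb{P}_{\Delta_2}=\mathbb{P}_{\Delta^\varphi}$; this is the induced degeneration $f$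 of the claim.
   Formalization: The sign of the added ray is corrected: z3≤0 for Δ1 (the part z3*≤0) and z3≥0 for Δ2, since as printed all rays of a complete fan would lie in one half-space (false for the cube); in "semistable", k is the dimension of the smallest face of Δ containing the ℓ-face. *)

theory Defs
  imports "HOL-Analysis.Analysis"
begin

text \<open>
  Both \<open>M\<^sub>\<real>\<close> and \<open>N\<^sub>\<real>\<close> are \<open>real ^ 3\<close>, with \<open>M = N = \<int>\<^sup>3\<close> and the inner product as the pairing.
  In a pair \<open>L\<close>, \<open>L'\<close> below, the pairing is assumed to identify \<open>L'\<close> with the dual lattice of \<open>L\<close>.
\<close>

definition int_lattice :: "(real ^ 'n) set" where
  "int_lattice = {x. \<forall>i. x $ i \<in> \<int>}"

definition lattice_polytope :: "(real ^ 'n) set \<Rightarrow> (real ^ 'n) set \<Rightarrow> bool" where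
  "lattice_polytope L P \<longleftrightarrow> (\<exists>S. finite S \<and> S \<subseteq> L \<and> P = convex hull S)"

definition dual_polytope :: "(real ^ 'n) set \<Rightarrow> (real ^ 'n) set \<Rightarrow> (real ^ 'n) set" where
  "dual_polytope V P = {v \<in> V. \<forall>m\<in>P. m \<bullet> v \<ge> -1}"

definition reflexive :: "(real ^ 'n) set \<Rightarrow> (real ^ 'n) set \<Rightarrow> (real ^ 'n) set \<Rightarrow> bool" where
  "reflexive L L' P \<longleftrightarrow>
     lattice_polytope L P \<and> span P = span L \<and> 0 \<in> rel_interior P \<and>
     lattice_polytope L' (dual_polytope (span L') P)"

text \<open>
  Inner normals, in agreement with the sign in \<^const>\<open>dual_polytope\<close>: the rays of the normal fan of a
  reflexive polytope are spanned by the vertices of its dual.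
\<close>

definition normal_cone :: "(real ^ 'n) set \<Rightarrow> (real ^ 'n) set \<Rightarrow> (real ^ 'n) set" where
  "normal_cone P F = {v. \<forall>x\<in>F. \<forall>y\<in>P. x \<bullet> v \<le> y \<bullet> v}"

definition normal_fan :: "(real ^ 'n) set \<Rightarrow> (real ^ 'n) set set" where
  "normal_fan P = {normal_cone P F | F. F face_of P \<and> F \<noteq> {}}"

definition fan_rays :: "(real ^ 'n) set set \<Rightarrow> (real ^ 'n) set set" where
  "fan_rays \<Sigma> = {\<sigma> \<in> \<Sigma>. dim \<sigma> = 1}"

definition simplicial_fan :: "(real ^ 'n) set set \<Rightarrow> bool" where
  "simplicial_fan \<Sigma> \<longleftrightarrow> (\<forall>\<sigma>\<in>\<Sigma>. \<exists>B. independent B \<and> \<sigma> = convex_cone hull B)"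

definition simple_polytope :: "(real ^ 'n) set \<Rightarrow> bool" where
  "simple_polytope P \<longleftrightarrow> simplicial_fan (normal_fan P)"

definition SL3Z :: "(real ^ 3 ^ 3) set" where
  "SL3Z = {A. (\<forall>i j. A $ i $ j \<in> \<int>) \<and> det A = 1}"

text \<open>
  The automorphism \<open>A\<close> of \<open>N\<close> provides the coordinates \<open>(z\<^sub>1, z\<^sub>2, z\<^sub>3)\<close> on \<open>N\<^sub>\<real>\<close>; the dual coordinates on
  \<open>M\<^sub>\<real>\<close> are those for which \<open>m \<bullet> v = zM A m \<bullet> zN A v\<close>.
\<close>

definition zN :: "real ^ 3 ^ 3 \<Rightarrow> real ^ 3 \<Rightarrow> real ^ 3" where
  "zN A v = A *v v"

definition zM :: "real ^ 3 ^ 3 \<Rightarrow> real ^ 3 \<Rightarrow> real ^ 3" where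
  "zM A m = transpose (matrix_inv A) *v m"

text \<open>
  The projection \<open>(z\<^sub>1, z\<^sub>2, z\<^sub>3) \<mapsto> (z\<^sub>1, z\<^sub>2)\<close> onto the summand \<open>{z\<^sub>3 = 0}\<close>, viewed inside \<open>N\<^sub>\<real>\<close>.
\<close>

definition proj_phi :: "real ^ 3 ^ 3 \<Rightarrow> real ^ 3 \<Rightarrow> real ^ 3" where
  "proj_phi A v = matrix_inv A *v vector [zN A v $ 1, zN A v $ 2, 0]"

definition M_phi :: "real ^ 3 ^ 3 \<Rightarrow> (real ^ 3) set" where
  "M_phi A = {m \<in> int_lattice. zM A m $ 3 = 0}"

definition candelas_1 :: "real ^ 3 ^ 3 \<Rightarrow> (real ^ 3) set \<Rightarrow> bool" where
  "candelas_1 A N\<phi> \<longleftrightarrow> N\<phi> = {v \<in> int_lattice. zN A v $ 3 = 0}"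

definition candelas_2 ::
    "real ^ 3 ^ 3 \<Rightarrow> (real ^ 3) set \<Rightarrow> (real ^ 3) set \<Rightarrow> (real ^ 3) set \<Rightarrow> bool" where
  "candelas_2 A N\<phi> Nabla Nabla\<phi> \<longleftrightarrow> proj_phi A ` (Nabla \<inter> int_lattice) = Nabla\<phi> \<inter> N\<phi>"

text \<open>A partition of a polytope \<open>P\<close> is given as the set \<open>Q\<close> of its pieces.\<close>

definition simple_partition :: "(real ^ 'n) set set \<Rightarrow> bool" where
  "simple_partition Q \<longleftrightarrow> (\<forall>R\<in>Q. simple_polytope R)"

definition smallest_face :: "(real ^ 'n) set \<Rightarrow> (real ^ 'n) set \<Rightarrow> (real ^ 'n) set \<Rightarrow> bool" where
  "smallest_face P G F \<longleftrightarrow>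
     F face_of P \<and> G \<subseteq> F \<and> (\<forall>F'. F' face_of P \<and> G \<subseteq> F' \<longrightarrow> F \<subseteq> F')"

text \<open>
  In the count \<open>k - \<ell> + 1\<close>, \<open>k\<close> has to be the dimension of the smallest face of \<open>P\<close> containing the
  \<open>\<ell>\<close>-face: that face lies in \<open>P\<close> itself as well, so with every such \<open>k\<close> allowed the counts would
  contradict each other.
\<close>

definition semistable_partition :: "(real ^ 'n) set \<Rightarrow> (real ^ 'n) set set \<Rightarrow> bool" where
  "semistable_partition P Q \<longleftrightarrow>
     (\<forall>R\<in>Q. \<forall>G F. G face_of R \<and> aff_dim G \<in> {1, 2} \<and> smallest_face P G F \<longrightarrow>
        int (card {R' \<in> Q. G \<subseteq> R'}) = aff_dim F - aff_dim G + 1)"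

definition new_vertices :: "(real ^ 'n) set \<Rightarrow> (real ^ 'n) set set \<Rightarrow> (real ^ 'n) set" where
  "new_vertices P Q = {x. (\<exists>R\<in>Q. x extreme_point_of R) \<and> \<not> x extreme_point_of P}"

definition balanced_partition :: "(real ^ 'n) set \<Rightarrow> (real ^ 'n) set set \<Rightarrow> bool" where
  "balanced_partition P Q \<longleftrightarrow> (\<forall>x\<in>new_vertices P Q. \<exists>e. e edge_of P \<and> x \<in> e)"

definition primitive_vector :: "real ^ 'n \<Rightarrow> bool" where
  "primitive_vector u \<longleftrightarrow>
     u \<in> int_lattice \<and> u \<noteq> 0 \<and> (\<forall>w\<in>int_lattice. \<forall>k::nat. u = real k *\<^sub>R w \<longrightarrow> k = 1)"

definition primitive_vectors_at :: "(real ^ 'n) set \<Rightarrow> real ^ 'n \<Rightarrow> (real ^ 'n) set" where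
  "primitive_vectors_at P x =
     {u. primitive_vector u \<and> (\<exists>e t. e edge_of P \<and> x \<in> e \<and> t > 0 \<and> x + t *\<^sub>R u \<in> e)}"

definition int_span :: "(real ^ 'n) set \<Rightarrow> (real ^ 'n) set" where
  "int_span S = {\<Sum>u\<in>T. real_of_int (c u) *\<^sub>R u | T c. finite T \<and> T \<subseteq> S}"

definition nonsingular_vertex :: "(real ^ 'n) set \<Rightarrow> real ^ 'n \<Rightarrow> bool" where
  "nonsingular_vertex P x \<longleftrightarrow> x extreme_point_of P \<and> int_span (primitive_vectors_at P x) = int_lattice"

definition mildly_singular_semistable :: "(real ^ 'n) set \<Rightarrow> (real ^ 'n) set set \<Rightarrow> bool" where
  "mildly_singular_semistable P Q \<longleftrightarrow>
     semistable_partition P Q \<and> balanced_partition P Q \<and>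
     (\<forall>x\<in>new_vertices P Q. \<forall>R\<in>Q. x extreme_point_of R \<longrightarrow> nonsingular_vertex R x)"

text \<open>
  The two halves \<open>{m \<in> \<Delta>. z\<^sub>3\<^sup>* \<le> 0}\<close> and \<open>{m \<in> \<Delta>. z\<^sub>3\<^sup>* \<ge> 0}\<close> are the pieces into which the dual of the
  two-dimensional polytope divides \<open>\<Delta>\<close>, since that dual is the section \<open>z\<^sub>3\<^sup>* = 0\<close>.
  The facets of \<open>\<Delta>\<close> with inner normal in \<open>z\<^sub>3 > 0\<close> lie in the half \<open>z\<^sub>3\<^sup>* \<le> 0\<close>, whose remaining facet, the
  section, has inner normal \<open>(0, 0, -1)\<close>.  The signs are opposite: the normal fan of a half is complete, so
  its rays do not all lie in one half-space.
\<close>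

lemma SL3Z_inverse:
  assumes "A \<in> SL3Z"
  shows "A ** matrix_inv A = mat 1" "matrix_inv A ** A = mat 1"
proof -
  have "invertible A"
    using assms by (simp add: SL3Z_def invertible_det_nz)
  then have "A ** matrix_inv A = mat 1 \<and> matrix_inv A ** A = mat 1"
    unfolding invertible_def matrix_inv_def by (rule someI_ex)
  then show "A ** matrix_inv A = mat 1" "matrix_inv A ** A = mat 1"
    by auto
qed

lemma zM_inner_zN:
  assumes "A \<in> SL3Z"
  shows "zM A m \<bullet> zN A v = m \<bullet> v"
proof -
  have "zM A m \<bullet> zN A v = m \<bullet> (matrix_inv A *v (A *v v))"
    unfolding zM_def zN_def by (simp add: dot_lmul_matrix)
  then show ?thesis
    by (simp add: matrix_vector_mul_assoc SL3Z_inverse[OF assms])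
qed

lemma zN_proj_phi:
  assumes "A \<in> SL3Z"
  shows "zN A (proj_phi A v) = vector [zN A v $ 1, zN A v $ 2, 0]"
  unfolding proj_phi_def
  by (subst zN_def) (simp add: matrix_vector_mul_assoc SL3Z_inverse[OF assms])

lemma bidual_subset:
  fixes P :: "(real ^ 'n) set"
  assumes "convex P" "closed P" "0 \<in> P"
  shows "dual_polytope UNIV (dual_polytope UNIV P) \<subseteq> P"
proof (rule ccontr)
  assume "\<not> dual_polytope UNIV (dual_polytope UNIV P) \<subseteq> P"
  then obtain m where m: "m \<in> dual_polytope UNIV (dual_polytope UNIV P)" "m \<notin> P"
    by auto
  then obtain a b where ab: "a \<bullet> m < b" "\<And>x. x \<in> P \<Longrightarrow> a \<bullet> x > b"
    using separating_hyperplane_closed_point[OF assms(1,2)] by metis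
  have b: "b < 0"
    using ab(2)[OF assms(3)] by simp
  define v where "v = (1 / (- b)) *\<^sub>R a"
  have "v \<in> dual_polytope UNIV P"
  proof -
    have "x \<bullet> v \<ge> -1" if "x \<in> P" for x
      using ab(2)[OF that] b by (simp add: v_def inner_commute field_simps)
    then show ?thesis
      by (simp add: dual_polytope_def)
  qed
  then have "v \<bullet> m \<ge> -1"
    using m(1) by (simp add: dual_polytope_def)
  then show False
    using ab(1) b by (simp add: v_def field_simps)
qed

lemma section_eq_dual:
  assumes "reflexive int_lattice int_lattice \<Delta>"
    and "Nabla = dual_polytope UNIV \<Delta>"
    and "A \<in> SL3Z"
    and "Nabla\<phi> \<subseteq> Nabla"
    and "candelas_2 A N\<phi> Nabla Nabla\<phi>"
  shows "{m \<in> \<Delta>. zM A m $ 3 = 0} = dual_polytope {m. zM A m $ 3 = 0} Nabla\<phi>"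
proof (intro set_eqI iffI)
  fix m assume "m \<in> {m \<in> \<Delta>. zM A m $ 3 = 0}"
  then show "m \<in> dual_polytope {m. zM A m $ 3 = 0} Nabla\<phi>"
    using assms(2,4) by (auto simp: dual_polytope_def inner_commute)
next
  fix m assume m: "m \<in> dual_polytope {m. zM A m $ 3 = 0} Nabla\<phi>"
  have sp: "span (int_lattice :: (real ^ 3) set) = UNIV"
  proof -
    have "Basis \<subseteq> (int_lattice :: (real ^ 3) set)"
      by (auto simp: int_lattice_def Basis_vec_def axis_def)
    then show ?thesis
      by (metis span_Basis span_mono top.extremum_uniqueI)
  qed
  obtain S where S: "S \<subseteq> int_lattice" "Nabla = convex hull S"
    using assms(1,2) sp by (auto simp: reflexive_def lattice_polytope_def)
  have "m \<bullet> s \<ge> -1" if "s \<in> S" for s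
  proof -
    have "proj_phi A s \<in> Nabla\<phi>"
      using that S assms(5) hull_subset[of S convex] by (auto simp: candelas_2_def)
    then have "m \<bullet> proj_phi A s \<ge> -1"
      using m by (auto simp: dual_polytope_def inner_commute)
    moreover have "m \<bullet> proj_phi A s = m \<bullet> s"
    proof -
      have "zM A m \<bullet> zN A (proj_phi A s) = zM A m \<bullet> zN A s"
        using m unfolding zN_proj_phi[OF assms(3)]
        by (simp add: inner_vec_def sum_3 dual_polytope_def)
      then show ?thesis
        by (simp only: zM_inner_zN[OF assms(3)])
    qed
    ultimately show ?thesis
      by simp
  qed
  then have "convex hull S \<subseteq> {v. m \<bullet> v \<ge> -1}"
    by (intro hull_minimal) (auto simp: convex_halfspace_ge)
  then have "m \<in> dual_polytope UNIV Nabla"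
    using S by (auto simp: dual_polytope_def inner_commute)
  moreover have "convex \<Delta>" "closed \<Delta>" "0 \<in> \<Delta>"
    using assms(1) rel_interior_subset[of \<Delta>]
    unfolding reflexive_def lattice_polytope_def
    by (auto intro: compact_imp_closed finite_imp_compact_convex_hull)
  ultimately show "m \<in> {m \<in> \<Delta>. zM A m $ 3 = 0}"
    using bidual_subset[of \<Delta>] assms(2) m by (auto simp: dual_polytope_def)
qed

end

theory Submission
  imports Defs
begin

text \<open>
  The rays of the normal fan of a full-dimensional polytope are spanned by the inner normals of its
  facets.  Since \<open>\<nabla>\<^sup>\<phi> \<subseteq> \<nabla> \<inter> {z\<^sub>3 = 0}\<close>, and since the dual of \<open>\<nabla>\<^sup>\<phi>\<close> is the section of \<open>\<Delta>\<close> by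
  \<open>z\<^sub>3\<^sup>* = 0\<close>, the projection that kills \<open>z\<^sub>3\<^sup>*\<close> maps \<open>\<Delta>\<close> into itself.  Comparing a point of a
  facet with its projection shows that a facet with inner normal in \<open>z\<^sub>3 > 0\<close> lies in \<open>z\<^sub>3\<^sup>* \<le> 0\<close>.
  A facet whose normal has \<open>z\<^sub>3 = 0\<close> is projected onto its own section by \<open>z\<^sub>3\<^sup>* = 0\<close>; if it were
  on one side of that plane, the section would be an edge of \<open>\<Delta>\<close> contained in both halves, which
  semistability forbids.
\<close>

section \<open>Rays of the normal fan as inner facet normals\<close>

definition min_face :: "(real ^ 'n) set \<Rightarrow> real ^ 'n \<Rightarrow> (real ^ 'n) set" where
  "min_face P v = {x \<in> P. \<forall>y\<in>P. x \<bullet> v \<le> y \<bullet> v}"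

text \<open>The dimension is measured against the ambient space, so this singles out facets for
  full-dimensional \<open>P\<close>. No normalisation is imposed on \<open>v\<close>, as only the
  ray it spans matters.\<close>

definition facet_normal :: "(real ^ 'n) set \<Rightarrow> real ^ 'n \<Rightarrow> bool" where
  "facet_normal P v \<longleftrightarrow> v \<noteq> 0 \<and> aff_dim (min_face P v) = int CARD('n) - 1"

definition ray :: "real ^ 'n \<Rightarrow> (real ^ 'n) set" where
  "ray v = {c *\<^sub>R v | c. c \<ge> 0}"

lemma ray_scaleR:
  assumes "c > 0"
  shows "ray (c *\<^sub>R v) = ray v"
proof -
  have "\<exists>k\<ge>0. d *\<^sub>R v = k *\<^sub>R c *\<^sub>R v" if "d \<ge> 0" for d
    using that assms by (intro exI[of _ "d / c"]) auto
  then show ?thesis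
    using assms by (fastforce simp: ray_def)
qed

text \<open>One known minimiser turns the face into a slice by a supporting hyperplane, the form
  suited to facts on faces and dimensions.\<close>

lemma min_face_supporting:
  assumes "x \<in> min_face P v"
  shows "min_face P v = P \<inter> {y. v \<bullet> y = v \<bullet> x}"
  using assms unfolding min_face_def inner_commute[of v] by (auto intro: order_antisym)

lemma min_face_face_of:
  assumes "convex P"
  shows "min_face P v face_of P"
proof (cases "min_face P v = {}")
  case False
  then obtain x where x: "x \<in> min_face P v"
    by blast
  then have "\<And>y. y \<in> P \<Longrightarrow> v \<bullet> y \<ge> v \<bullet> x"
    by (auto simp: min_face_def inner_commute)
  with assms show ?thesis
    unfolding min_face_supporting[OF x] by (rule face_of_Int_supporting_hyperplane_ge)
qed simp

lemma proper_face_eq_min_face: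
  assumes "polytope P" "F face_of P" "F \<noteq> {}" "F \<noteq> P"
  obtains v where "v \<noteq> 0" "F = min_face P v"
proof -
  have "F exposed_face_of P"
    using assms by (simp add: exposed_face_of_polyhedron polytope_imp_polyhedron)
  then obtain a b where ab: "a \<noteq> 0" "P \<subseteq> {x. a \<bullet> x \<le> b}" "F = P \<inter> {x. a \<bullet> x = b}"
    using assms by (auto simp: exposed_face_of)
  obtain x where x: "x \<in> F"
    using assms by blast
  \<comment> \<open>An exposed face is given as the locus where \<open>a\<close> is maximal; inner
    normals minimise, hence the sign.\<close>
  then have "x \<in> min_face P (- a)"
    using ab by (auto simp: min_face_def inner_commute)
  then have "min_face P (- a) = F"
    using ab x by (simp add: min_face_supporting)
  then show thesis
    using that[of "- a"] ab by simp
qed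

lemma affine_hull_eq_hyperplane:
  fixes F :: "(real ^ 'n) set"
  assumes "aff_dim F = int CARD('n) - 1" "F \<subseteq> {x. a \<bullet> x = b}" "a \<noteq> 0"
  shows "affine hull F = {x. a \<bullet> x = b}"
proof (rule affine_dim_equal)
  show "affine hull F \<noteq> {}"
    using assms by auto
  show "affine hull F \<subseteq> {x. a \<bullet> x = b}"
    using assms by (intro hull_minimal) (auto simp: affine_hyperplane)
qed (use assms in \<open>auto simp: affine_hyperplane\<close>)

lemma not_constant_on_interior:
  fixes v :: "real ^ 'n"
  assumes "interior P \<noteq> {}" "v \<noteq> 0" "P \<subseteq> {x. v \<bullet> x = b}"
  shows False
proof -
  have "interior P \<subseteq> interior {x. v \<bullet> x = b}"
    using assms(3) by (rule interior_mono)
  then show False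
    using assms by (simp add: interior_hyperplane)
qed

text \<open>The component of \<open>v\<close> orthogonal to \<open>e\<close> lies in the hyperplane,
  so it is orthogonal to \<open>v\<close> and therefore to itself.\<close>

lemma vanishing_on_hyperplane:
  fixes v e :: "'a :: real_inner"
  assumes "e \<noteq> 0" "\<And>x. e \<bullet> x = 0 \<Longrightarrow> v \<bullet> x = 0"
  shows "v = ((e \<bullet> v) / (e \<bullet> e)) *\<^sub>R e"
proof -
  define w where "w = v - ((e \<bullet> v) / (e \<bullet> e)) *\<^sub>R e"
  have ew: "e \<bullet> w = 0"
    using assms(1) by (simp add: w_def inner_diff_right)
  then have "v \<bullet> w = 0"
    by (rule assms(2))
  then have "w \<bullet> w = 0"
    using ew by (subst (1) w_def) (simp add: inner_diff_left)
  then show ?thesis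
    by (simp add: w_def)
qed

text \<open>\<open>F\<close> affinely spans its hyperplane, so \<open>w\<close> is constant there
  and vanishes on the orthogonal complement of \<open>v\<close>.\<close>

lemma constant_on_facet:
  fixes v w :: "real ^ 'n"
  assumes "aff_dim F = int CARD('n) - 1" "v \<noteq> 0" "F \<subseteq> {x. v \<bullet> x = b}" "F \<subseteq> {x. w \<bullet> x = d}"
  shows "w = ((v \<bullet> w) / (v \<bullet> v)) *\<^sub>R v"
proof (rule vanishing_on_hyperplane)
  fix x assume x: "v \<bullet> x = 0"
  have hull: "affine hull F = {x. v \<bullet> x = b}"
    by (rule affine_hull_eq_hyperplane) fact+
  have sub: "affine hull F \<subseteq> {x. w \<bullet> x = d}"
    using assms(4) by (intro hull_minimal) (auto simp: affine_hyperplane)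
  obtain y where "y \<in> F"
    using assms(1) by (cases "F = {}") auto
  then have "y \<in> affine hull F" "y + x \<in> affine hull F"
    using x assms(3) by (auto simp: hull hull_inc inner_add_right)
  then have "w \<bullet> y = d" "w \<bullet> (y + x) = d"
    using sub by blast+
  then show "w \<bullet> x = 0"
    by (simp add: inner_add_right)
qed fact

text \<open>A vector in the cone is constant on the facet, hence a multiple of \<open>v\<close>; a
  point of \<open>P\<close> off the facet fixes the sign of the factor.\<close>

lemma normal_cone_facet_eq_ray:
  fixes v :: "real ^ 'n"
  assumes "interior P \<noteq> {}" "facet_normal P v"
  shows "normal_cone P (min_face P v) = ray v"
proof
  have v: "v \<noteq> 0" "aff_dim (min_face P v) = int CARD('n) - 1"
    using assms(2) by (auto simp: facet_normal_def)
  then obtain x where x: "x \<in> min_face P v"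
    by (cases "min_face P v = {}") auto
  then have xP: "x \<in> P" "\<And>y. y \<in> P \<Longrightarrow> x \<bullet> v \<le> y \<bullet> v"
    by (auto simp: min_face_def)
  show "ray v \<subseteq> normal_cone P (min_face P v)"
    by (auto simp: ray_def normal_cone_def min_face_def intro!: mult_left_mono)
  show "normal_cone P (min_face P v) \<subseteq> ray v"
  proof
    fix w assume w: "w \<in> normal_cone P (min_face P v)"
    have "min_face P v \<subseteq> {y. w \<bullet> y = w \<bullet> x}"
      using w x
      by (auto simp: normal_cone_def min_face_def inner_commute[of w] intro: order_antisym)
    moreover have "min_face P v \<subseteq> {y. v \<bullet> y = v \<bullet> x}"
      using min_face_supporting[OF x] by blast
    ultimately obtain c where c: "w = c *\<^sub>R v"
      using constant_on_facet[OF v(2,1)] by blast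
    have "\<not> P \<subseteq> {y. v \<bullet> y = v \<bullet> x}"
      using not_constant_on_interior assms(1) v(1) by blast
    then obtain y where y: "y \<in> P" "x \<bullet> v < y \<bullet> v"
      using xP by (force simp: inner_commute)
    have "x \<bullet> w \<le> y \<bullet> w"
      using w x y by (auto simp: normal_cone_def)
    then have "c \<ge> 0"
      using y by (auto simp: c mult_le_cancel_left)
    then show "w \<in> ray v"
      using c by (auto simp: ray_def)
  qed
qed

lemma dim_ray:
  assumes "v \<noteq> 0"
  shows "dim (ray v) = 1"
proof -
  have "v \<in> ray v"
    unfolding ray_def by (rule CollectI, rule exI[of _ 1]) simp
  moreover have "ray v \<subseteq> span {v}"
    by (auto simp: ray_def span_singleton)
  ultimately have "span (ray v) = span {v}"
    by (simp add: span_eq span_base)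
  then have "dim (ray v) = dim {v}"
    by (rule span_eq_dim)
  then show ?thesis
    using assms by simp
qed

lemma dim_1_multiple:
  fixes v w :: "'a :: euclidean_space"
  assumes "dim S = 1" "v \<in> S" "w \<in> S" "v \<noteq> 0"
  obtains c where "w = c *\<^sub>R v"
proof -
  have "span {v} = span S"
    using assms by (intro dim_eq_span) auto
  then have "w \<in> span {v}"
    using assms by (simp add: span_base)
  then show thesis
    using that by (auto simp: span_singleton)
qed

text \<open>If the cone of \<open>F\<close> has dimension one, a normal \<open>v\<close> exposing
  \<open>F\<close> and a normal \<open>w\<close> of a facet containing \<open>F\<close> are
  proportional. The cone is pointed, so the factor is positive and \<open>F\<close> is that
  facet.\<close>

lemma fan_rays_normal_fan:
  fixes P :: "(real ^ 'n) set"
  assumes P: "polytope P" and int: "interior P \<noteq> {}"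
  shows "fan_rays (normal_fan P) = ray ` {v. facet_normal P v}"
proof (intro equalityI subsetI)
  fix \<rho> assume "\<rho> \<in> ray ` {v. facet_normal P v}"
  then obtain v where v: "facet_normal P v" "\<rho> = ray v"
    by blast
  moreover have "min_face P v \<noteq> {}"
    using v(1) by (auto simp: facet_normal_def)
  ultimately show "\<rho> \<in> fan_rays (normal_fan P)"
    using normal_cone_facet_eq_ray[OF int v(1)] min_face_face_of[OF polytope_imp_convex[OF P]]
      dim_ray[of v]
    by (auto simp: fan_rays_def normal_fan_def facet_normal_def)
next
  fix \<rho> assume "\<rho> \<in> fan_rays (normal_fan P)"
  then obtain F where F: "F face_of P" "F \<noteq> {}" "\<rho> = normal_cone P F" and dim: "dim \<rho> = 1"
    by (auto simp: fan_rays_def normal_fan_def)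
  obtain x where x: "x \<in> F" "x \<in> P"
    using F face_of_imp_subset by blast
  \<comment> \<open>Pointedness: \<open>v\<close> and \<open>- v\<close> together would confine
    \<open>P\<close> to a hyperplane.\<close>
  have not_both: False if "v \<noteq> 0" "v \<in> \<rho>" "- v \<in> \<rho>" for v
  proof -
    have "P \<subseteq> {y. v \<bullet> y = v \<bullet> x}"
      using that x F(3)
      by (auto simp: normal_cone_def inner_commute[of v] intro: order_antisym)
    then show False
      using not_constant_on_interior[OF int] that by blast
  qed
  \<comment> \<open>The normal cone of \<open>P\<close> itself is closed under negation, against
    pointedness.\<close>
  have "F \<noteq> P"
  proof
    assume "F = P"
    then have "- v \<in> \<rho>" if "v \<in> \<rho>" for v
      using that F(3) by (auto simp: normal_cone_def)
    moreover obtain v where "v \<in> \<rho>" "v \<noteq> 0"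
      using dim dim_eq_0[of \<rho>] by auto
    ultimately show False
      using not_both by blast
  qed
  then obtain v where v: "v \<noteq> 0" "F = min_face P v"
    using proper_face_eq_min_face[OF P F(1,2)] by blast
  obtain G where G: "G facet_of P" "F \<subseteq> G"
    using face_of_polyhedron_subset_facet[OF polytope_imp_polyhedron[OF P] F(1,2) \<open>F \<noteq> P\<close>] by blast
  have aff_G: "aff_dim G = int CARD('n) - 1"
    using G(1) int by (simp add: facet_of_def aff_dim_nonempty_interior)
  have "G \<noteq> P"
    using aff_G aff_dim_nonempty_interior[OF int] by auto
  then obtain w where w: "w \<noteq> 0" "G = min_face P w"
    using proper_face_eq_min_face[OF P facet_of_imp_face_of[OF G(1)]] G F(2) by blast
  have v\<rho>: "v \<in> \<rho>"
    by (auto simp: F(3) v(2) normal_cone_def min_face_def)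
  have w\<rho>: "w \<in> \<rho>"
    using G(2) unfolding F(3) w(2) by (auto simp: normal_cone_def min_face_def)
  obtain c where c: "w = c *\<^sub>R v"
    using dim_1_multiple[OF dim v\<rho> w\<rho> v(1)] .
  have "c > 0"
  proof (rule ccontr)
    assume "\<not> c > 0"
    then have "c < 0"
      using c w(1) by (cases "c = 0") auto
    then have "- v \<in> \<rho>"
      using w\<rho> by (auto simp: c F(3) normal_cone_def mult_le_cancel_left)
    then show False
      using not_both v(1) v\<rho> by blast
  qed
  then have "min_face P w = min_face P v"
    by (auto simp: c min_face_def)
  then have "facet_normal P v"
    using v(1) w(2) aff_G by (simp add: facet_normal_def)
  then show "\<rho> \<in> ray ` {v. facet_normal P v}"
    using normal_cone_facet_eq_ray[OF int] F(3) v(2) by auto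
qed

section \<open>Cutting a polytope by a plane through an interior point\<close>

locale split_polytope =
  fixes \<Delta> :: "(real ^ 3) set" and e g :: "real ^ 3"
  assumes poly: "polytope \<Delta>"
    and zero_interior: "0 \<in> interior \<Delta>"
    and dual_pair: "g \<bullet> e = 1"
    and proj_closed: "m \<in> \<Delta> \<Longrightarrow> m - (m \<bullet> e) *\<^sub>R g \<in> \<Delta>"
    and no_edge_in_section: "E edge_of \<Delta> \<Longrightarrow> \<not> E \<subseteq> {m. m \<bullet> e = 0}"
begin

text \<open>The assumptions are invariant under negating both \<open>e\<close> and \<open>g\<close>,
  so the opposite half is another instance of the same argument.\<close>

definition half :: "(real ^ 3) set" where
  "half = {m \<in> \<Delta>. m \<bullet> e \<le> 0}"

lemma e_nonzero: "e \<noteq> 0"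
  using dual_pair by auto

lemma half_eq: "half = \<Delta> \<inter> {m. e \<bullet> m \<le> 0}"
  by (auto simp: half_def inner_commute)

lemma polytope_half: "polytope half"
  unfolding half_eq by (intro polytope_Int_polyhedron poly polyhedron_halfspace_le)

lemma interior_point_below: "\<exists>m\<in>interior \<Delta>. m \<bullet> e < 0"
proof -
  obtain r where r: "r > 0" "ball 0 r \<subseteq> interior \<Delta>"
    using zero_interior open_contains_ball[of "interior \<Delta>"] by auto
  \<comment> \<open>A vector of norm \<open>r / 2\<close> in direction \<open>- e\<close>.\<close>
  define m where "m = - ((r / 2) / norm e) *\<^sub>R e"
  have "norm m < r"
    using r(1) e_nonzero by (simp add: m_def)
  then have "m \<in> interior \<Delta>"
    using r(2) by (auto simp: subset_eq)
  moreover have "m \<bullet> e < 0"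
    using r(1) e_nonzero by (simp add: m_def field_simps)
  ultimately show ?thesis
    by blast
qed

lemma interior_half: "interior half \<noteq> {}"
proof -
  have "{m. e \<bullet> m < 0} \<inter> interior \<Delta> \<subseteq> interior half"
    by (rule interior_maximal)
      (use interior_subset in \<open>auto simp: half_eq intro!: open_Int open_halfspace_lt\<close>)
  then show ?thesis
    using interior_point_below by (auto simp: inner_commute)
qed

text \<open>Moving a minimiser along \<open>g\<close> into the plane stays in \<Delta> and changes
  its pairing with \<open>v\<close> by \<open>- (m \<bullet> e) * (g \<bullet> v)\<close>, which
  cannot be negative.\<close>

lemma min_face_sign:
  assumes "m \<in> min_face \<Delta> v"
  shows "(m \<bullet> e) * (g \<bullet> v) \<le> 0"
proof -
  have "m - (m \<bullet> e) *\<^sub>R g \<in> \<Delta>"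
    using assms by (intro proj_closed) (simp add: min_face_def)
  then have "m \<bullet> v \<le> (m - (m \<bullet> e) *\<^sub>R g) \<bullet> v"
    using assms unfolding min_face_def by blast
  then show ?thesis
    by (simp add: inner_diff_left)
qed

text \<open>A minimiser over \<Delta> that lies in the half forces the two minimum values to
  agree.\<close>

lemma min_face_half:
  assumes "x \<in> min_face \<Delta> v" "x \<bullet> e \<le> 0"
  shows "min_face half v = min_face \<Delta> v \<inter> {m. m \<bullet> e \<le> 0}"
proof -
  have x: "x \<in> half" "\<And>y. y \<in> \<Delta> \<Longrightarrow> x \<bullet> v \<le> y \<bullet> v"
    using assms by (auto simp: min_face_def half_def)
  show ?thesis
  proof (intro equalityI subsetI)
    fix m assume m: "m \<in> min_face half v"
    then have "m \<bullet> v \<le> x \<bullet> v"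
      using x(1) by (simp add: min_face_def)
    then show "m \<in> min_face \<Delta> v \<inter> {m. m \<bullet> e \<le> 0}"
      using m x(2) by (auto simp: min_face_def half_def intro: order_trans)
  qed (auto simp: min_face_def half_def)
qed

lemma vertical_facet_crosses:
  assumes v: "facet_normal \<Delta> v" and gv: "g \<bullet> v = 0"
  shows "\<exists>x\<in>min_face \<Delta> v. x \<bullet> e < 0"
proof (rule ccontr)
  define F where "F = min_face \<Delta> v"
  define E where "E = F \<inter> {m. e \<bullet> m = 0}"
  assume "\<not> ?thesis"
  then have above: "\<And>x. x \<in> F \<Longrightarrow> e \<bullet> x \<ge> 0"
    by (force simp: F_def inner_commute)
  have v0: "v \<noteq> 0" and dimF: "aff_dim F = 2"
    using v by (auto simp: facet_normal_def F_def)
  obtain x where x: "x \<in> F"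
    using dimF by (cases "F = {}") auto
  have F: "F = \<Delta> \<inter> {y. v \<bullet> y = v \<bullet> x}"
    unfolding F_def by (rule min_face_supporting) (use x F_def in simp)
  \<comment> \<open>As \<open>g \<bullet> v = 0\<close>, moving along \<open>g\<close> stays in the
    supporting plane of \<open>F\<close>.\<close>
  have proj: "m - (m \<bullet> e) *\<^sub>R g \<in> E" if "m \<in> F" for m
    using that proj_closed[of m] gv dual_pair
    by (auto simp: E_def F inner_diff_right inner_commute)
  have F_face: "F face_of \<Delta>"
    unfolding F_def by (intro min_face_face_of polytope_imp_convex poly)
  then have convF: "convex F"
    by (rule face_of_imp_convex)
  have E_face: "E face_of F"
    unfolding E_def using above by (intro face_of_Int_supporting_hyperplane_ge convF) auto
  have "E \<noteq> F"
  proof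
    assume "E = F"
    then have "F \<subseteq> {m. e \<bullet> m = 0}"
      by (auto simp: E_def)
    moreover have "F \<subseteq> {y. v \<bullet> y = v \<bullet> x}"
      using F by blast
    \<comment> \<open>Two functionals constant on a facet are proportional; pairing with
      \<open>g\<close> then gives 1 = 0.\<close>
    ultimately have "e = ((v \<bullet> e) / (v \<bullet> v)) *\<^sub>R v"
      using dimF v0 by (intro constant_on_facet[of F]) auto
    then have "g \<bullet> e = ((v \<bullet> e) / (v \<bullet> v)) * (g \<bullet> v)"
      by (metis inner_scaleR_right)
    then show False
      using gv dual_pair by simp
  qed
  then have "aff_dim E < 2"
    using face_of_aff_dim_lt[OF convF E_face] dimF by simp
  moreover have "aff_dim E \<ge> 1"
  proof (rule ccontr)
    assume "\<not> aff_dim E \<ge> 1"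
    moreover have "aff_dim E \<ge> 0"
      using proj[OF x] by (auto simp flip: not_less)
    ultimately have "aff_dim E = 0"
      by simp
    then obtain a where a: "E = {a}"
      by (auto simp: aff_dim_eq_0)
    \<comment> \<open>If \<open>E\<close> is one point, all of \<open>F\<close> projects to it along
      \<open>g\<close> and lies on a line, against dimension two.\<close>
    have "F \<subseteq> affine hull {a, a + g}"
    proof
      fix m assume "m \<in> F"
      then have "m = a + (m \<bullet> e) *\<^sub>R g"
        using proj[of m] a by (simp add: algebra_simps)
      then have "m = (1 - m \<bullet> e) *\<^sub>R a + (m \<bullet> e) *\<^sub>R (a + g)"
        by (simp add: algebra_simps)
      then show "m \<in> affine hull {a, a + g}"
        unfolding affine_hull_2 by (metis (mono_tags, lifting) CollectI diff_add_cancel)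
    qed
    then have "aff_dim F \<le> aff_dim {a, a + g}"
      by (metis aff_dim_affine_hull aff_dim_subset)
    then show False
      using dimF by (simp split: if_splits)
  qed
  ultimately have "E edge_of \<Delta>"
    using face_of_trans[OF E_face F_face] by (simp add: edge_of_def)
  then show False
    using no_edge_in_section[of E] by (auto simp: E_def inner_commute)
qed

text \<open>An open half-space meeting a convex set cuts out a part of full dimension; the closed
  cut lies between that part and the whole.\<close>

lemma aff_dim_below:
  assumes "convex F" "x \<in> F" "x \<bullet> e < 0"
  shows "aff_dim (F \<inter> {m. m \<bullet> e \<le> 0}) = aff_dim F"
proof (rule order_antisym)
  have "aff_dim (F \<inter> {m. e \<bullet> m < 0}) = aff_dim F"
    using assms
    by (intro aff_dim_convex_Int_open open_halfspace_lt) (auto simp: inner_commute[of e])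
  moreover have "aff_dim (F \<inter> {m. e \<bullet> m < 0}) \<le> aff_dim (F \<inter> {m. m \<bullet> e \<le> 0})"
    by (intro aff_dim_subset) (auto simp: inner_commute)
  ultimately show "aff_dim F \<le> aff_dim (F \<inter> {m. m \<bullet> e \<le> 0})"
    by simp
qed (simp add: aff_dim_subset)

text \<open>A facet with \<open>g \<bullet> v > 0\<close> lies wholly in the half; one with
  \<open>g \<bullet> v = 0\<close> reaches strictly below the plane, so truncation keeps its
  dimension.\<close>

lemma facet_normal_half_of_facet_normal:
  assumes v: "facet_normal \<Delta> v" and gv: "g \<bullet> v \<ge> 0"
  shows "facet_normal half v"
proof (cases "g \<bullet> v = 0")
  case True
  then obtain x where x: "x \<in> min_face \<Delta> v" "x \<bullet> e < 0"
    using vertical_facet_crosses[OF v] by blast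
  have "convex (min_face \<Delta> v)"
    using min_face_face_of[OF polytope_imp_convex[OF poly]] by (rule face_of_imp_convex)
  then show ?thesis
    using v x min_face_half[of x v] aff_dim_below[of "min_face \<Delta> v" x]
    by (simp add: facet_normal_def)
next
  case False
  then have "min_face \<Delta> v \<subseteq> {m. m \<bullet> e \<le> 0}"
    using min_face_sign[of _ v] gv by (auto simp: mult_le_0_iff)
  moreover obtain x where "x \<in> min_face \<Delta> v"
    using v by (cases "min_face \<Delta> v = {}") (auto simp: facet_normal_def)
  ultimately have "min_face half v = min_face \<Delta> v"
    using min_face_half[of x v] by blast
  then show ?thesis
    using v by (simp add: facet_normal_def)
qed

text \<open>The plane passes through the interior point 0, so the section is
  two-dimensional.\<close>

lemma facet_normal_half_section: "facet_normal half (- e)"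
proof -
  have "0 \<in> min_face half (- e)"
    using zero_interior interior_subset by (auto simp: min_face_def half_def)
  then have "min_face half (- e) = half \<inter> {m. - e \<bullet> m = - e \<bullet> 0}"
    by (rule min_face_supporting)
  also have "\<dots> = {m. e \<bullet> m = 0} \<inter> \<Delta>"
    by (auto simp: half_eq)
  finally have "min_face half (- e) = {m. e \<bullet> m = 0} \<inter> \<Delta>" .
  moreover have "aff_dim ({m. e \<bullet> m = 0} \<inter> interior \<Delta>) = aff_dim {m. e \<bullet> m = 0}"
  proof (intro aff_dim_convex_Int_open convex_hyperplane open_interior)
    have "0 \<in> {m. e \<bullet> m = 0} \<inter> interior \<Delta>"
      using zero_interior by simp
    then show "{m. e \<bullet> m = 0} \<inter> interior \<Delta> \<noteq> {}"
      by blast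
  qed
  moreover have "aff_dim ({m. e \<bullet> m = 0} \<inter> interior \<Delta>) \<le> aff_dim ({m. e \<bullet> m = 0} \<inter> \<Delta>)"
    "aff_dim ({m. e \<bullet> m = 0} \<inter> \<Delta>) \<le> aff_dim {m. e \<bullet> m = 0}"
    using interior_subset by (intro aff_dim_subset; blast)+
  ultimately show ?thesis
    using e_nonzero by (simp add: facet_normal_def)
qed

text \<open>At a facet point strictly below the plane, minimality over the half extends to \<Delta>
  by convexity. Without such a point the facet lies in the plane.\<close>

lemma facet_normal_half_cases:
  assumes "facet_normal half v"
  shows "(facet_normal \<Delta> v \<and> g \<bullet> v \<ge> 0) \<or> (\<exists>c>0. v = c *\<^sub>R (- e))"
proof (cases "\<exists>x\<in>min_face half v. x \<bullet> e < 0")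
  case True
  then obtain x where x: "x \<in> min_face half v" "x \<bullet> e < 0"
    by blast
  have v: "v \<noteq> 0" "aff_dim (min_face half v) = 2"
    using assms by (auto simp: facet_normal_def)
  have xD: "x \<in> \<Delta>"
    using x by (simp add: min_face_def half_def)
  have "x \<bullet> v \<le> y \<bullet> v" if y: "y \<in> \<Delta>" for y
  proof (cases "y \<bullet> e \<le> 0")
    case True
    then show ?thesis
      using x y by (simp add: min_face_def half_def)
  next
    case False
    \<comment> \<open>the parameter at which the segment from \<open>x\<close> to \<open>y\<close> leaves the half\<close>
    define s where "s = (x \<bullet> e) / (x \<bullet> e - y \<bullet> e)"
    define z where "z = (1 - s) *\<^sub>R x + s *\<^sub>R y"
    have s: "0 < s" "s < 1"
      using False x(2) by (auto simp: s_def divide_simps)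
    have "z \<in> \<Delta>"
      unfolding z_def using s xD y polytope_imp_convex[OF poly] by (intro convexD) auto
    moreover have "z \<bullet> e = x \<bullet> e - s * (x \<bullet> e - y \<bullet> e)"
      by (simp add: z_def inner_add_left algebra_simps)
    then have "z \<bullet> e = 0"
      using False x(2) by (simp add: s_def)
    ultimately have "x \<bullet> v \<le> z \<bullet> v"
      using x(1) by (simp add: min_face_def half_def)
    then have "s * (x \<bullet> v) \<le> s * (y \<bullet> v)"
      by (simp add: z_def inner_add_left algebra_simps)
    then show ?thesis
      using s by simp
  qed
  then have xm: "x \<in> min_face \<Delta> v"
    using xD by (simp add: min_face_def)
  \<comment> \<open>The facet of the half sits in \<open>min_face \<Delta> v\<close>, which lies in
    a plane, so both have dimension two.\<close>
  have "aff_dim (min_face half v) \<le> aff_dim (min_face \<Delta> v)"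
    using min_face_half[OF xm] x(2) by (intro aff_dim_subset) auto
  moreover have "aff_dim (min_face \<Delta> v) \<le> aff_dim {y. v \<bullet> y = v \<bullet> x}"
    using min_face_supporting[OF xm] by (intro aff_dim_subset) auto
  ultimately have "facet_normal \<Delta> v"
    using v by (simp add: facet_normal_def)
  moreover have "g \<bullet> v \<ge> 0"
    using min_face_sign[OF xm] x(2) by (auto simp: mult_le_0_iff)
  ultimately show ?thesis
    by blast
next
  case False
  have v: "v \<noteq> 0" "aff_dim (min_face half v) = 2"
    using assms by (auto simp: facet_normal_def)
  obtain x where x: "x \<in> min_face half v"
    using v(2) by (cases "min_face half v = {}") auto
  have sub: "min_face half v \<subseteq> {m. e \<bullet> m = 0}"
    using False by (force simp: min_face_def half_def inner_commute)
  moreover have "min_face half v \<subseteq> {y. v \<bullet> y = v \<bullet> x}"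
    using min_face_supporting[OF x] by blast
  ultimately obtain c where c: "v = c *\<^sub>R e"
    using constant_on_facet[of "min_face half v" e 0 v] v(2) e_nonzero by auto
  \<comment> \<open>A point of the half strictly below the plane decides the sign of
    \<open>c\<close>.\<close>
  obtain m where m: "m \<in> interior \<Delta>" "m \<bullet> e < 0"
    using interior_point_below by blast
  then have "m \<in> half"
    using interior_subset by (auto simp: half_def)
  then have "x \<bullet> v \<le> m \<bullet> v"
    using x by (simp add: min_face_def)
  moreover have "x \<bullet> e = 0"
    using sub x by (auto simp: inner_commute)
  ultimately have "c \<le> 0"
    using m(2) by (simp add: c zero_le_mult_iff)
  then have "- c > 0" "v = (- c) *\<^sub>R (- e)"
    using c v(1) by (cases "c = 0"; simp)+
  then show ?thesis
    by blast
qed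

theorem fan_rays_half:
  "fan_rays (normal_fan half) =
     {\<rho> \<in> fan_rays (normal_fan \<Delta>). \<forall>v\<in>\<rho>. g \<bullet> v \<ge> 0} \<union> {ray (- e)}"
proof -
  \<comment> \<open>The condition on a whole ray reduces to its generator, so facet normals can
    replace rays.\<close>
  have nonneg: "(\<forall>w\<in>ray v. g \<bullet> w \<ge> 0) \<longleftrightarrow> g \<bullet> v \<ge> 0" for v
  proof
    assume "\<forall>w\<in>ray v. g \<bullet> w \<ge> 0"
    moreover have "v \<in> ray v"
      unfolding ray_def by (rule CollectI, rule exI[of _ 1]) simp
    ultimately show "g \<bullet> v \<ge> 0"
      by blast
  qed (auto simp: ray_def)
  have "interior \<Delta> \<noteq> {}"
    using zero_interior by blast
  then have rays: "fan_rays (normal_fan \<Delta>) = ray ` {v. facet_normal \<Delta> v}"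
    by (rule fan_rays_normal_fan[OF poly])
  show ?thesis
    unfolding fan_rays_normal_fan[OF polytope_half interior_half] rays
  proof (intro equalityI subsetI)
    fix \<rho> assume "\<rho> \<in> ray ` {v. facet_normal half v}"
    then obtain v where v: "facet_normal half v" "\<rho> = ray v"
      by blast
    from facet_normal_half_cases[OF v(1)]
    show "\<rho> \<in> {\<rho> \<in> ray ` {v. facet_normal \<Delta> v}. \<forall>v\<in>\<rho>. g \<bullet> v \<ge> 0} \<union> {ray (- e)}"
    proof
      assume "facet_normal \<Delta> v \<and> g \<bullet> v \<ge> 0"
      then show ?thesis
        using nonneg[of v] v(2) by blast
    next
      assume "\<exists>c>0. v = c *\<^sub>R (- e)"
      then show ?thesis
        using v(2) ray_scaleR[of _ "- e"] by auto
    qed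
  next
    fix \<rho> assume "\<rho> \<in> {\<rho> \<in> ray ` {v. facet_normal \<Delta> v}. \<forall>v\<in>\<rho>. g \<bullet> v \<ge> 0} \<union> {ray (- e)}"
    then show "\<rho> \<in> ray ` {v. facet_normal half v}"
      using nonneg facet_normal_half_of_facet_normal facet_normal_half_section by blast
  qed
qed

end

section \<open>Reflexivity, semistability and the two halves\<close>

lemma reflexive_int_lattice:
  fixes P :: "(real ^ 'n) set"
  assumes "reflexive int_lattice L' P"
  shows "polytope P" "0 \<in> interior P"
proof -
  show "polytope P"
    using assms by (auto simp: reflexive_def lattice_polytope_def polytope_def)
  \<comment> \<open>The standard basis makes \<open>span P\<close> the whole space, and
    \<open>0 \<in> P\<close> identifies the affine hull with the span.\<close>
  have "Basis \<subseteq> (int_lattice :: (real ^ 'n) set)"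
    by (auto simp: int_lattice_def Basis_vec_def axis_def)
  then have "span (int_lattice :: (real ^ 'n) set) = UNIV"
    by (metis span_Basis span_mono top.extremum_uniqueI)
  then have "span P = UNIV" and z: "0 \<in> rel_interior P"
    using assms by (auto simp: reflexive_def)
  moreover have "0 \<in> P"
    using z rel_interior_subset by blast
  ultimately have "affine hull P = UNIV"
    by (metis affine_hull_span_0 hull_inc)
  then show "0 \<in> interior P"
    using z rel_interior_interior by blast
qed

text \<open>An edge of \<open>P\<close> is the smallest face containing itself, so the prescribed
  count is 1 - 1 + 1 = 1, yet both pieces contain it.\<close>

lemma semistable_no_edge:
  assumes ss: "semistable_partition P {Q, R}" and ne: "Q \<noteq> R" and QP: "Q \<subseteq> P"
    and E: "E edge_of P" "E \<subseteq> Q" "E \<subseteq> R"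
  shows False
proof -
  have face: "E face_of P" "aff_dim E = 1"
    using E(1) by (auto simp: edge_of_def)
  have "E face_of Q"
    using face(1) E(2) QP by (rule face_of_subset)
  moreover have "smallest_face P E E"
    using face(1) by (simp add: smallest_face_def)
  ultimately have "int (card {R' \<in> {Q, R}. E \<subseteq> R'}) = 1"
    using ss face(2) unfolding semistable_partition_def by fastforce
  moreover have "{R' \<in> {Q, R}. E \<subseteq> R'} = {Q, R}"
    using E by auto
  ultimately show False
    using ne by simp
qed

theorem theorem6p6:
  fixes \<Delta> Nabla N\<phi> Nabla\<phi> \<Delta>1 \<Delta>2 :: "(real ^ 3) set" and A :: "real ^ 3 ^ 3"
  assumes "reflexive int_lattice int_lattice \<Delta>"
    and "Nabla = dual_polytope UNIV \<Delta>"
    and "A \<in> SL3Z"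
    and "candelas_1 A N\<phi>"
    and "reflexive N\<phi> (M_phi A) Nabla\<phi>"
    and "Nabla\<phi> \<subseteq> Nabla"
    and "candelas_2 A N\<phi> Nabla Nabla\<phi>"
    and "simple_polytope \<Delta>"
    and "\<Delta>1 = {m \<in> \<Delta>. zM A m $ 3 \<le> 0}"
    and "\<Delta>2 = {m \<in> \<Delta>. zM A m $ 3 \<ge> 0}"
    and "simple_partition {\<Delta>1, \<Delta>2}"
    and "mildly_singular_semistable \<Delta> {\<Delta>1, \<Delta>2}"
  shows "fan_rays (normal_fan \<Delta>1) =
           {\<rho> \<in> fan_rays (normal_fan \<Delta>). \<forall>v\<in>\<rho>. zN A v $ 3 \<ge> 0} \<union>
           {{v. zN A v $ 1 = 0 \<and> zN A v $ 2 = 0 \<and> zN A v $ 3 \<le> 0}}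
       \<and> fan_rays (normal_fan \<Delta>2) =
           {\<rho> \<in> fan_rays (normal_fan \<Delta>). \<forall>v\<in>\<rho>. zN A v $ 3 \<le> 0} \<union>
           {{v. zN A v $ 1 = 0 \<and> zN A v $ 2 = 0 \<and> zN A v $ 3 \<ge> 0}}"
proof -
  \<comment> \<open>\<open>e\<close> and \<open>g\<close> represent the coordinates \<open>z\<^sub>3\<^sup>*\<close> on \<open>M\<^sub>\<real>\<close> and \<open>z\<^sub>3\<close> on \<open>N\<^sub>\<real>\<close>\<close>
  define e where "e = matrix_inv A *v axis 3 1"
  define g where "g = transpose A *v axis 3 1"
  have zNe: "zN A e = axis 3 1"
    by (simp add: e_def zN_def matrix_vector_mul_assoc SL3Z_inverse[OF assms(3)])
  have z3M: "zM A m $ 3 = m \<bullet> e" for m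
    using zM_inner_zN[OF assms(3), of m e] by (simp add: zNe inner_axis)
  have z3N: "zN A v $ 3 = g \<bullet> v" for v
    unfolding g_def zN_def by (simp add: dot_lmul_matrix inner_axis')
  have ge: "g \<bullet> e = 1"
    using z3N[of e] by (simp add: zNe)
  note \<Delta> = reflexive_int_lattice[OF assms(1)]
  have Nabla_phi: "g \<bullet> u = 0" if "u \<in> Nabla\<phi>" for u
  proof -
    obtain S where S: "S \<subseteq> N\<phi>" "Nabla\<phi> = convex hull S"
      using assms(5) by (auto simp: reflexive_def lattice_polytope_def)
    have "convex hull S \<subseteq> {u. g \<bullet> u = 0}"
      using S(1) assms(4) by (intro hull_minimal) (auto simp: candelas_1_def z3N convex_hyperplane)
    then show ?thesis
      using that S(2) by blast
  qed
  have proj: "m - (m \<bullet> e) *\<^sub>R g \<in> \<Delta>" if "m \<in> \<Delta>" for m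
  proof -
    \<comment> \<open>\<open>u\<close> is orthogonal to \<open>g\<close>, so the projection of
      \<open>m\<close> keeps the inequalities defining the dual of \<open>Nabla\<phi>\<close>, which
      is the section of \<Delta>.\<close>
    have "u \<bullet> (m - (m \<bullet> e) *\<^sub>R g) \<ge> - 1" if "u \<in> Nabla\<phi>" for u
      using that \<open>m \<in> \<Delta>\<close> Nabla_phi[of u] assms(2,6)
      by (auto simp: dual_polytope_def inner_diff_right inner_commute)
    then have "m - (m \<bullet> e) *\<^sub>R g \<in> dual_polytope {m. zM A m $ 3 = 0} Nabla\<phi>"
      using ge by (simp add: dual_polytope_def z3M inner_diff_left)
    then show ?thesis
      using section_eq_dual[OF assms(1,2,3,6,7)] by blast
  qed
  \<comment> \<open>The semistable count is over a set of pieces, so they must be distinct; equal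
    halves would flatten \<Delta> into a plane.\<close>
  have ne: "\<Delta>1 \<noteq> \<Delta>2"
  proof
    assume "\<Delta>1 = \<Delta>2"
    then have "\<Delta> \<subseteq> {m. e \<bullet> m = 0}"
      unfolding assms(9,10) z3M inner_commute[of e] set_eq_iff
      by (metis (mono_tags, lifting) linorder_linear mem_Collect_eq order_antisym subsetI)
    moreover have "e \<noteq> 0"
      using ge by auto
    ultimately show False
      using not_constant_on_interior[of \<Delta> e 0] \<Delta>(2) by blast
  qed
  have edge: "\<not> E \<subseteq> {m. m \<bullet> e = 0}" if "E edge_of \<Delta>" for E
  proof
    assume "E \<subseteq> {m. m \<bullet> e = 0}"
    moreover have "E \<subseteq> \<Delta>"
      using that by (auto simp: edge_of_def dest: face_of_imp_subset)
    ultimately have "E \<subseteq> \<Delta>1" "E \<subseteq> \<Delta>2" "\<Delta>1 \<subseteq> \<Delta>"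
      by (auto simp: assms(9,10) z3M)
    then show False
      using semistable_no_edge[OF _ ne _ that] assms(12)
      by (auto simp: mildly_singular_semistable_def)
  qed
  interpret lower: split_polytope \<Delta> e g
    using \<Delta> ge proj edge by unfold_locales auto
  interpret upper: split_polytope \<Delta> "- e" "- g"
    using \<Delta> ge proj edge by unfold_locales auto
  \<comment> \<open>\<open>e\<close> spans the line where the first two coordinates vanish, and
    \<open>g\<close> reads off the coordinate along it.\<close>
  have axis: "(zN A v $ 1 = 0 \<and> zN A v $ 2 = 0) \<longleftrightarrow> v = (g \<bullet> v) *\<^sub>R e" for v
  proof
    assume "zN A v $ 1 = 0 \<and> zN A v $ 2 = 0"
    then have "zN A v = (g \<bullet> v) *\<^sub>R axis 3 1"
      by (simp add: vec_eq_iff forall_3 axis_def z3N)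
    then have "matrix_inv A *v zN A v = (g \<bullet> v) *\<^sub>R e"
      by (simp add: e_def matrix_vector_mult_scaleR)
    then show "v = (g \<bullet> v) *\<^sub>R e"
      by (simp add: zN_def matrix_vector_mul_assoc SL3Z_inverse[OF assms(3)])
  next
    assume "v = (g \<bullet> v) *\<^sub>R e"
    then have "zN A v = (g \<bullet> v) *\<^sub>R zN A e"
      unfolding zN_def by (metis matrix_vector_mult_scaleR)
    then show "zN A v $ 1 = 0 \<and> zN A v $ 2 = 0"
      by (simp add: zNe axis_def)
  qed
  have axis_ray: "{v. v = (g \<bullet> v) *\<^sub>R e \<and> g \<bullet> v \<ge> 0} = ray e"
    using ge by (auto simp: ray_def)
  have axis_ray_neg: "{v. v = (g \<bullet> v) *\<^sub>R e \<and> g \<bullet> v \<le> 0} = ray (- e)"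
  proof -
    have "\<exists>c\<ge>0. v = - (c *\<^sub>R e)" if "v = (g \<bullet> v) *\<^sub>R e" "g \<bullet> v \<le> 0" for v
      using that by (intro exI[of _ "- (g \<bullet> v)"]) auto
    then show ?thesis
      using ge by (auto simp: ray_def)
  qed
  have "\<Delta>1 = lower.half" "\<Delta>2 = upper.half"
    by (auto simp: assms(9,10) lower.half_def upper.half_def z3M)
  \<comment> \<open>In the upper instance the added ray is that of \<open>- (- e)\<close>, and
    nonnegativity of \<open>- g\<close> means a nonpositive third coordinate.\<close>
  then show ?thesis
    using lower.fan_rays_half upper.fan_rays_half
    by (simp add: z3N axis axis_ray axis_ray_neg conj_assoc[symmetric])
qed

end
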